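(* Let $(X,\mathsf{d})$ be a geodesic metric space and let $\mu$ be a Radon measure on $X$ with $\mu(X)<\infty$ which puts no mass on non-proper chains. Then for any $N\in\mathbb{Z}_{>0}$, $$\mathrm{Mag}(X,\mathsf{d},\mu,\Gamma^{\mathrm{triv}};N)=\mu(X)+\sum_{n=1}^N(-1)^n\int_{X^{n+1}}e^{-\sum_{k=1}^n\mathsf{d}(x_{k-1},x_k)}\,\mathrm{d}\mu^{n+1}.$$ In particular, $\mathrm{Mag}(X,\mathsf{d},\mu,\Gamma^{\mathrm{triv}};N)=\mathrm{Mag}(X,\mathsf{d},\mu;N)$.
   Context: A geodesic metric space is one in which any two points are joined by a path whose length equals their distance. Points of $X^{n+1}$ are written $(x_0,\dots,x_n)$ and $\mu^{n+1}$ is the product measure. For $n\ge 1$, $P_n(X):=\{(x_0,\dots,x_n)\in X^{n+1}\mid x_{k-1}\ne x_k \text{ for } k=1,\dots,n\}$; $\mu$ puts no mass on non-proper chains if $\mu^{n+1}(X^{n+1}\setminus P_n(X))=0$ for all $n\in\mathbb{Z}_{>0}$. The $N$-th partial $\mu$-magnitude is $$\mathrm{Mag}(X,\mathsf{d},\mu;N):=\mu(X)+\sum_{n=1}^N(-1)^n\int_{P_n(X)}e^{-\sum_{k=1}^n\mathsf{d}(x_{k-1},x_k)}\,\mathrm{d}\mu^{n+1}.$$ Let $\Omega_{x,y}$ be the set of non-constant length-minimising geodesics from $x$ to $y$ (empty if $x=y$), and $\Gamma^{\mathrm{triv}}_{x,y}$ the measure on $\{\emptyset,\Omega_{x,y}\}$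 with $\Gamma^{\mathrm{triv}}_{x,y}(\Omega_{x,y})=1$ if $\Omega_{x,y}\ne\emptyset$. For $\bm{x}\in P_n(X)$, $\Omega_{\bm{x}}=\prod_{k=1}^n\Omega_{x_{k-1},x_k}$ carries the product measure $\Gamma^{\mathrm{triv}}_{\bm{x}}$, and $\mathrm{Len}(\gamma)=\sum_{k=1}^n\mathsf{d}(x_{k-1},x_k)$ for $\gamma\in\Omega_{\bm{x}}$. Then $$\mathrm{Mag}(X,\mathsf{d},\mu,\Gamma^{\mathrm{triv}};N):=\mu(X)+\sum_{n=1}^N(-1)^n\int_{P_n(X)}\Big(\int_{\Omega_{\bm{x}}}e^{-\mathrm{Len}(\gamma)}\,\mathrm{d}\Gamma^{\mathrm{triv}}_{\bm{x}}\Big)\mathrm{d}\mu^{n+1}.$$ *)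

theory Defs
  imports "HOL-Analysis.Analysis"
begin

definition path_length :: "(real \<Rightarrow> 'a::metric_space) \<Rightarrow> real \<Rightarrow> real \<Rightarrow> ennreal" where
  "path_length g a b =
     (SUP (m, t) \<in> {(m::nat, t::nat \<Rightarrow> real).
                      t 0 = a \<and> t m = b \<and> (\<forall>i<m. t i \<le> t (Suc i))}.
        ennreal (\<Sum>i<m. dist (g (t i)) (g (t (Suc i)))))"

text \<open>A property of the metric of the type \<open>'a\<close>, which plays the role of the space $X$.\<close>

definition geodesic_space :: "'a::metric_space itself \<Rightarrow> bool" where
  "geodesic_space _ \<longleftrightarrow>
     (\<forall>x y :: 'a. \<exists>g. path g \<and> pathstart g = x \<and> pathfinish g = y \<and>
        path_length g 0 1 = ennreal (dist x y))"

definition radon_measure :: "'a::metric_space measure \<Rightarrow> bool" where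
  "radon_measure M \<longleftrightarrow>
     sets M = sets borel \<and>
     (\<forall>x. \<exists>U. open U \<and> x \<in> U \<and> emeasure M U < \<infinity>) \<and>
     (\<forall>A\<in>sets borel. emeasure M A = (SUP K\<in>{K. compact K \<and> K \<subseteq> A}. emeasure M K))"

text \<open>
  Points $(x_0,\dots,x_n)$ of $X^{n+1}$ are functions on \<open>{..n}\<close>, \<open>undefined\<close> elsewhere.
  The product measure is completed because for non-separable $X$ the distance function need
  not be measurable for the product of the Borel \<open>\<sigma>\<close>-algebras. A finite Radon measure is
  concentrated on a \<open>\<sigma>\<close>-compact, hence separable, set, so that distances and the sets of
  proper chains are always measurable for the completion.
\<close>

definition prod_measure :: "'a measure \<Rightarrow> nat \<Rightarrow> (nat \<Rightarrow> 'a) measure" where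
  "prod_measure M n = completion (\<Pi>\<^sub>M i\<in>{..n}. M)"

definition proper_chains :: "nat \<Rightarrow> (nat \<Rightarrow> 'a) set" where
  "proper_chains n = {x \<in> {..n} \<rightarrow>\<^sub>E UNIV. \<forall>k\<in>{1..n}. x (k - 1) \<noteq> x k}"

text \<open>Membership in \<open>null_sets\<close>, rather than \<open>emeasure _ _ = 0\<close>, which also holds for
  non-measurable sets.\<close>

definition no_mass_on_nonproper_chains :: "'a measure \<Rightarrow> bool" where
  "no_mass_on_nonproper_chains M \<longleftrightarrow>
     (\<forall>n\<ge>1. ({..n} \<rightarrow>\<^sub>E UNIV) - proper_chains n \<in> null_sets (prod_measure M n))"

definition chain_length :: "nat \<Rightarrow> (nat \<Rightarrow> 'a::metric_space) \<Rightarrow> real" where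
  "chain_length n x = (\<Sum>k=1..n. dist (x (k - 1)) (x k))"

definition partial_magnitude :: "'a::metric_space measure \<Rightarrow> nat \<Rightarrow> real" where
  "partial_magnitude M N =
     measure M UNIV +
     (\<Sum>n=1..N. (-1) ^ n * (LINT x:proper_chains n|prod_measure M n. exp (- chain_length n x)))"

text \<open>
  Geodesics are parametrised on $[0,1]$ with constant speed \<open>c\<close>; the restriction to
  \<open>extensional {0..1}\<close> makes the values outside $[0,1]$ irrelevant.
\<close>

definition min_geodesics :: "'a::metric_space \<Rightarrow> 'a \<Rightarrow> (real \<Rightarrow> 'a) set" where
  "min_geodesics x y =
     {g \<in> extensional {0..1}.
        path g \<and> pathstart g = x \<and> pathfinish g = y \<and>
        path_length g 0 1 = ennreal (dist x y) \<and>
        (\<exists>c\<ge>0. \<forall>s t. 0 \<le> s \<and> s \<le> t \<and> t \<le> 1 \<longrightarrow> path_length g s t = ennreal (c * (t - s))) \<and>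
        \<not> g constant_on {0..1}}"

definition triv_geodesic_measure :: "'a::metric_space \<Rightarrow> 'a \<Rightarrow> (real \<Rightarrow> 'a) measure" where
  "triv_geodesic_measure x y =
     measure_of (min_geodesics x y) {{}, min_geodesics x y} (\<lambda>A. if A = {} then 0 else 1)"

definition geodesic_chain_measure ::
  "('a \<Rightarrow> 'a \<Rightarrow> (real \<Rightarrow> 'a) measure) \<Rightarrow> nat \<Rightarrow> (nat \<Rightarrow> 'a) \<Rightarrow> (nat \<Rightarrow> real \<Rightarrow> 'a) measure" where
  "geodesic_chain_measure \<Gamma> n x = (\<Pi>\<^sub>M k\<in>{1..n}. \<Gamma> (x (k - 1)) (x k))"

definition geodesic_chain_length :: "nat \<Rightarrow> (nat \<Rightarrow> real \<Rightarrow> 'a::metric_space) \<Rightarrow> real" where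
  "geodesic_chain_length n \<gamma> = (\<Sum>k=1..n. enn2real (path_length (\<gamma> k) 0 1))"

definition geodesic_partial_magnitude ::
  "'a::metric_space measure \<Rightarrow> ('a \<Rightarrow> 'a \<Rightarrow> (real \<Rightarrow> 'a) measure) \<Rightarrow> nat \<Rightarrow> real" where
  "geodesic_partial_magnitude M \<Gamma> N =
     measure M UNIV +
     (\<Sum>n=1..N. (-1) ^ n *
        (LINT x:proper_chains n|prod_measure M n.
           (LINT \<gamma>|geodesic_chain_measure \<Gamma> n x. exp (- geodesic_chain_length n \<gamma>))))"

lemma geodesic_chain_length_eq:
  assumes "\<gamma> \<in> (\<Pi>\<^sub>E k\<in>{1..n}. min_geodesics (x (k - 1)) (x k))"
  shows "geodesic_chain_length n \<gamma> = chain_length n x"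
  unfolding geodesic_chain_length_def chain_length_def
proof (rule sum.cong)
  fix k assume "k \<in> {1..n}"
  with assms have "\<gamma> k \<in> min_geodesics (x (k - 1)) (x k)"
    by (rule PiE_mem)
  then show "enn2real (path_length (\<gamma> k) 0 1) = dist (x (k - 1)) (x k)"
    by (simp add: min_geodesics_def)
qed simp

lemma min_geodesics_refl: "min_geodesics x x = {}"
proof (rule equals0I)
  fix g :: "real \<Rightarrow> 'a" assume g: "g \<in> min_geodesics x x"
  have "g t = g 0" if t: "t \<in> {0..1}" for t
  proof -
    let ?p = "\<lambda>i::nat. if i = 0 then 0 else if i = 1 then t else (1::real)"
    have "ennreal (\<Sum>i<2. dist (g (?p i)) (g (?p (Suc i)))) \<le> path_length g 0 1"
      unfolding path_length_def by (rule SUP_upper2[of "(2, ?p)"]) (use t in auto)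
    also have "\<dots> = 0" using g by (simp add: min_geodesics_def)
    finally have "(\<Sum>i<2. dist (g (?p i)) (g (?p (Suc i)))) \<le> 0"
      by (simp add: ennreal_eq_0_iff)
    moreover have "(\<Sum>i<2. dist (g (?p i)) (g (?p (Suc i)))) = dist (g 0) (g t) + dist (g t) (g 1)"
      by (simp add: numeral_2_eq_2)
    ultimately have "dist (g 0) (g t) \<le> 0" using zero_le_dist[of "g t" "g 1"] by linarith
    then show ?thesis by simp
  qed
  then have "g constant_on {0..1}" unfolding constant_on_def by blast
  with g show False by (simp add: min_geodesics_def)
qed

lemma space_triv_geodesic_measure: "space (triv_geodesic_measure x y) = min_geodesics x y"
  by (auto simp: triv_geodesic_measure_def space_measure_of_conv)

lemma sets_triv_geodesic_measure: "sets (triv_geodesic_measure x y) = {{}, min_geodesics x y}"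
  unfolding triv_geodesic_measure_def
  by (subst sigma_algebra.sets_measure_of_eq[OF sigma_algebra_trivial]) simp

lemma emeasure_triv_geodesic_measure:
  assumes "min_geodesics x y \<noteq> {}"
  shows "emeasure (triv_geodesic_measure x y) (min_geodesics x y) = 1"
proof -
  let ?S = "{{}, min_geodesics x y}" and ?f = "\<lambda>A. if A = {} then 0 else 1 :: ennreal"
  have "countably_additive ?S ?f"
  proof (rule countably_additiveI)
    fix A :: "nat \<Rightarrow> (real \<Rightarrow> 'a) set"
    assume A: "range A \<subseteq> ?S" "disjoint_family A"
    show "(\<Sum>i. ?f (A i)) = ?f (\<Union> (range A))"
    proof (cases "\<forall>i. A i = {}")
      case False
      then obtain j where j: "A j \<noteq> {}" by blast
      have Aj: "A j = min_geodesics x y" using A(1) j by blast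
      have "A i = {}" if "i \<noteq> j" for i
      proof -
        have "A i \<inter> A j = {}" using A(2) that by (auto simp: disjoint_family_on_def)
        then show ?thesis using A(1) Aj assms by blast
      qed
      then have "(\<Sum>i. ?f (A i)) = (\<Sum>i\<in>{j}. ?f (A i))" by (intro suminf_finite) auto
      then show ?thesis using j by auto
    qed auto
  qed
  then show ?thesis
    unfolding triv_geodesic_measure_def
    by (subst emeasure_measure_of_sigma[OF sigma_algebra_trivial])
       (use assms in \<open>auto simp: positive_def\<close>)
qed

end

theory Submission
  imports Defs
begin

text \<open>In a geodesic space any two distinct points are joined by a shortest path, and
  reparametrising it by the distance from its start gives it constant speed
  (\<open>min_geodesics_nonempty\<close>). Hence over a proper chain each factor of the trivial
  measure has mass 1, and so has their product. The length is constant on that product, so the inner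
  integral is \<open>exp (- chain_length n x)\<close>
  (\<open>integral_exp_geodesic_chain_length\<close>), and the two magnitudes agree. The non-proper
  chains form a null set, so the outer integral may be taken over the whole power
  (\<open>set_lebesgue_integral_completion_conull\<close>).\<close>

lemma path_length_ge_sum:
  assumes "t 0 = a" "t m = b" "\<And>i. i < m \<Longrightarrow> t i \<le> t (Suc i)"
  shows "ennreal (\<Sum>i<m. dist (g (t i)) (g (t (Suc i)))) \<le> path_length g a b"
  unfolding path_length_def by (rule SUP_upper2[of "(m, t)"]) (use assms in auto)

text \<open>Every partition sum telescopes to the same value, so the supremum is that value; the
  partition with the single step from \<open>a\<close> to \<open>b\<close> already attains
  it.\<close>

lemma path_length_eq:
  fixes g :: "real \<Rightarrow> 'a::metric_space"
  assumes dist: "\<And>u v. a \<le> u \<Longrightarrow> u \<le> v \<Longrightarrow> v \<le> b \<Longrightarrow> dist (g u) (g v) = c * (v - u)"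
    and "a \<le> b"
  shows "path_length g a b = ennreal (c * (b - a))"
proof (rule antisym)
  show "path_length g a b \<le> ennreal (c * (b - a))"
    unfolding path_length_def
  proof (rule SUP_least, clarify)
    fix m :: nat and t :: "nat \<Rightarrow> real"
    assume ends: "a = t 0" "b = t m" and mono: "\<forall>i<m. t i \<le> t (Suc i)"
    have le: "t i \<le> t j" if "i \<le> j" "j \<le> m" for i j
      using that
    proof (induction j rule: dec_induct)
      case (step k)
      then show ?case using mono by (meson Suc_le_lessD less_imp_le order_trans)
    qed simp
    have "(\<Sum>i<m. dist (g (t i)) (g (t (Suc i)))) = (\<Sum>i<m. c * t (Suc i) - c * t i)"
    proof (rule sum.cong)
      fix i assume "i \<in> {..<m}"
      then have "dist (g (t i)) (g (t (Suc i))) = c * (t (Suc i) - t i)"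
        by (intro dist) (auto simp: ends intro!: le)
      then show "dist (g (t i)) (g (t (Suc i))) = c * t (Suc i) - c * t i"
        by (simp add: right_diff_distrib)
    qed simp
    also have "\<dots> = c * (t m - t 0)"
      by (subst sum_lessThan_telescope) (simp add: right_diff_distrib)
    finally show "ennreal (\<Sum>i<m. dist (g (t i)) (g (t (Suc i)))) \<le> ennreal (c * (t m - t 0))"
      by simp
  qed
next
  have "ennreal (\<Sum>i<1. dist (g (if i = 0 then a else b)) (g (if Suc i = 0 then a else b)))
        \<le> path_length g a b"
    by (rule path_length_ge_sum) (use \<open>a \<le> b\<close> in auto)
  then show "ennreal (c * (b - a)) \<le> path_length g a b"
    using dist[of a b] \<open>a \<le> b\<close> by simp
qed

text \<open>The partition 0, \<open>s\<close>, \<open>t\<close>, 1 cannot give more than the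
  distance of the endpoints, which forces equality in the triangle inequalities. So the distance
  from \<open>g 0\<close> is nondecreasing along \<open>g\<close> and determines all distances
  between points of \<open>g\<close>.\<close>

lemma dist_along_shortest_path:
  assumes g: "path_length g 0 1 = ennreal (dist (g 0) (g 1))"
    and st: "0 \<le> s" "s \<le> t" "t \<le> 1"
  shows "dist (g s) (g t) = dist (g 0) (g t) - dist (g 0) (g s)"
proof -
  define p :: "nat \<Rightarrow> real" where "p = (\<lambda>i. [0, s, t, 1] ! i)"
  have "p i \<le> p (Suc i)" if "i < 3" for i
    using that st by (auto simp: p_def less_Suc_eq numeral_3_eq_3)
  then have "ennreal (\<Sum>i<3. dist (g (p i)) (g (p (Suc i)))) \<le> path_length g 0 1"
    by (intro path_length_ge_sum) (auto simp: p_def numeral_3_eq_3)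
  also have "(\<Sum>i<3. dist (g (p i)) (g (p (Suc i))))
      = dist (g 0) (g s) + dist (g s) (g t) + dist (g t) (g 1)"
    by (simp add: p_def numeral_3_eq_3)
  finally have "dist (g 0) (g s) + dist (g s) (g t) + dist (g t) (g 1) \<le> dist (g 0) (g 1)"
    by (simp add: g ennreal_le_iff del: ennreal_plus)
  then show ?thesis
    using dist_triangle[of "g 0" "g 1" "g t"] dist_triangle[of "g 0" "g t" "g s"] by linarith
qed

text \<open>A shortest path \<open>g\<close> becomes a constant-speed one when it is reparametrised by
  \<open>t \<mapsto> dist x (g t)\<close>, which is onto the interval \<open>{0..dist x y}\<close> by the intermediate value theorem.\<close>

lemma min_geodesics_nonempty:
  fixes x y :: "'a::metric_space"
  assumes "geodesic_space TYPE('a)" and "x \<noteq> y"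
  shows "min_geodesics x y \<noteq> {}"
proof -
  obtain g where g: "path g" "g 0 = x" "g 1 = y" "path_length g 0 1 = ennreal (dist x y)"
    using assms(1) unfolding geodesic_space_def pathstart_def pathfinish_def by blast
  have dist_g: "dist (g s) (g t) = \<bar>dist x (g t) - dist x (g s)\<bar>"
    if "s \<in> {0..1}" "t \<in> {0..1}" for s t
  proof -
    have "dist (g s) (g t) = dist x (g t) - dist x (g s)" if "0 \<le> s" "s \<le> t" "t \<le> 1" for s t
      using dist_along_shortest_path[of g s t] g that by simp
    from this[of s t] this[of t s] that show ?thesis
      using zero_le_dist[of "g s" "g t"] by (cases "s \<le> t") (simp_all add: dist_commute)
  qed
  have "\<exists>t\<in>{0..1}. dist x (g t) = u * dist x y" if "u \<in> {0..1}" for u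
  proof -
    have "continuous_on {0..1} (\<lambda>t. dist x (g t))"
      using g(1) unfolding path_def by (intro continuous_intros)
    moreover have "u * dist x y \<le> dist x y"
      using that by (simp add: mult_left_le_one_le)
    ultimately have "\<exists>t\<ge>0. t \<le> 1 \<and> dist x (g t) = u * dist x y"
      using that g by (intro IVT') auto
    then show ?thesis by auto
  qed
  \<comment> \<open>The choice of \<open>\<tau>\<close> is arbitrary and may be discontinuous.
    Continuity of \<open>g \<circ> \<tau>\<close> comes from \<open>dist_g\<close>, which sees only
    distances from \<open>x\<close>, and these are linear in \<open>u\<close>.\<close>
  then obtain \<tau> where \<tau>: "\<And>u. u \<in> {0..1} \<Longrightarrow> \<tau> u \<in> {0..1}"
    "\<And>u. u \<in> {0..1} \<Longrightarrow> dist x (g (\<tau> u)) = u * dist x y"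
    by metis
  define h where "h = restrict (g \<circ> \<tau>) {0..1}"
  have dist_h: "dist (h u) (h v) = dist x y * \<bar>v - u\<bar>" if "u \<in> {0..1}" "v \<in> {0..1}" for u v
  proof -
    have "dist (h u) (h v) = \<bar>v * dist x y - u * dist x y\<bar>"
      using that dist_g \<tau> by (simp add: h_def)
    also have "\<dots> = dist x y * \<bar>v - u\<bar>"
      by (simp add: left_diff_distrib[symmetric] abs_mult mult.commute)
    finally show ?thesis .
  qed
  have h0: "h 0 = x"
    using \<tau>(2)[of 0] by (simp add: h_def)
  \<comment> \<open>\<open>\<tau> 1\<close> need not be 1, but \<open>g (\<tau> 1)\<close> and
    \<open>g 1\<close> are equally far from \<open>x\<close>, so \<open>dist_g\<close> identifies
    them.\<close>
  have "dist (h 1) y = 0"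
    using dist_g[of "\<tau> 1" 1] \<tau>[of 1] g by (simp add: h_def)
  then have h1: "h 1 = y" by simp
  have "(dist x y)-lipschitz_on {0..1} h"
    by (intro lipschitz_onI) (use dist_h in \<open>auto simp: dist_real_def abs_minus_commute\<close>)
  then have path: "path h"
    unfolding path_def by (rule lipschitz_on_continuous_on)
  have len: "path_length h s t = ennreal (dist x y * (t - s))"
    if "0 \<le> s" "s \<le> t" "t \<le> 1" for s t
    by (intro path_length_eq) (use that dist_h in auto)
  have "\<not> h constant_on {0..1}"
    using h0 h1 \<open>x \<noteq> y\<close> unfolding constant_on_def by (metis atLeastAtMost_iff order_refl zero_le_one)
  moreover have "h \<in> extensional {0..1}"
    by (simp add: h_def)
  moreover have "\<exists>c\<ge>0. \<forall>s t. 0 \<le> s \<and> s \<le> t \<and> t \<le> 1 \<longrightarrow> path_length h s t = ennreal (c * (t - s))"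
    using len zero_le_dist by blast
  ultimately have "h \<in> min_geodesics x y"
    using path h0 h1 len[of 0 1] by (simp add: min_geodesics_def pathstart_def pathfinish_def)
  then show ?thesis by blast
qed

text \<open>Pairs without geodesics, whose measure is zero, are included because
  \<open>product_sigma_finite\<close> ranges over all indices. At index 0, for instance,
  \<open>x (0 - 1)\<close> is \<open>x 0\<close>.\<close>

lemma finite_measure_triv_geodesic_measure: "finite_measure (triv_geodesic_measure x y)"
  by (rule finite_measureI, cases "min_geodesics x y = {}")
    (simp_all add: space_triv_geodesic_measure emeasure_triv_geodesic_measure)

lemma integral_exp_geodesic_chain_length:
  fixes x :: "nat \<Rightarrow> 'a::metric_space"
  assumes "geodesic_space TYPE('a)" and "x \<in> proper_chains n"
  shows "(LINT \<gamma>|geodesic_chain_measure triv_geodesic_measure n x. exp (- geodesic_chain_length n \<gamma>))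
         = exp (- chain_length n x)"
proof -
  let ?T = "\<lambda>k. triv_geodesic_measure (x (k - 1)) (x k)"
  let ?M = "geodesic_chain_measure triv_geodesic_measure n x"
  interpret product_sigma_finite ?T
    by unfold_locales
      (meson finite_measure_def finite_measure_triv_geodesic_measure sigma_finite_measure.sigma_finite_countable)
  have space: "space ?M = (\<Pi>\<^sub>E k\<in>{1..n}. min_geodesics (x (k - 1)) (x k))"
    by (simp add: geodesic_chain_measure_def space_PiM space_triv_geodesic_measure)
  have "emeasure ?M (space ?M) = (\<Prod>k=1..n. emeasure (?T k) (space (?T k)))"
    unfolding geodesic_chain_measure_def space_PiM by (rule emeasure_PiM) auto
  also have "\<dots> = (\<Prod>k=1..n. 1)"
  proof (rule prod.cong)
    fix k assume "k \<in> {1..n}"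
    then have "min_geodesics (x (k - 1)) (x k) \<noteq> {}"
      using assms by (intro min_geodesics_nonempty) (auto simp: proper_chains_def)
    then show "emeasure (?T k) (space (?T k)) = 1"
      by (simp add: space_triv_geodesic_measure emeasure_triv_geodesic_measure)
  qed simp
  finally have prob: "measure ?M (space ?M) = 1"
    by (simp add: measure_def)
  have "(LINT \<gamma>|?M. exp (- geodesic_chain_length n \<gamma>)) = (LINT \<gamma>|?M. exp (- chain_length n x))"
    by (intro Bochner_Integration.integral_cong)
      (simp_all add: space geodesic_chain_length_eq)
  also have "\<dots> = exp (- chain_length n x)"
    by (simp add: prob)
  finally show ?thesis .
qed

text \<open>The preimages of a set under \<open>f\<close> and \<open>g\<close> differ by a null set,
  and in a complete measure space such a change preserves measurability.\<close>

lemma (in complete_measure) measurable_AE_eq: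
  assumes "f \<in> measurable M N" and "AE x in M. f x = g x" and "\<And>x. x \<in> space M \<Longrightarrow> g x \<in> space N"
  shows "g \<in> measurable M N"
proof (rule measurableI)
  fix A assume "A \<in> sets N"
  show "g -` A \<inter> space M \<in> sets M"
  proof (rule in_sets_AE)
    show "AE x in M. x \<in> f -` A \<inter> space M \<longleftrightarrow> x \<in> g -` A \<inter> space M"
      using assms(2) by eventually_elim auto
  qed (use assms(1) \<open>A \<in> sets N\<close> in auto)
qed (fact assms(3))

text \<open>By completeness, both integrands are measurable or neither is; in the latter case both
  integrals are \<open>0\<close> by convention.\<close>

lemma set_lebesgue_integral_completion_conull:
  fixes f :: "'a \<Rightarrow> 'b::{banach, second_countable_topology}"
  assumes null: "space M - A \<in> null_sets (completion M)" and "A \<subseteq> space M"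
  shows "(LINT x:A|completion M. f x) = (LINT x|completion M. f x)"
proof -
  let ?g = "\<lambda>x. indicator A x *\<^sub>R f x"
  have ae: "AE x in completion M. ?g x = f x"
    by (rule AE_I'[OF null]) (auto simp: indicator_def)
  then have ae': "AE x in completion M. f x = ?g x"
    by eventually_elim simp
  have iff: "?g \<in> borel_measurable (completion M) \<longleftrightarrow> f \<in> borel_measurable (completion M)"
    using completion.measurable_AE_eq[OF _ ae, of borel] completion.measurable_AE_eq[OF _ ae', of borel]
    by fastforce
  have "integral\<^sup>L (completion M) ?g = integral\<^sup>L (completion M) f"
  proof (cases "f \<in> borel_measurable (completion M)")
    case True
    with iff ae show ?thesis by (intro integral_cong_AE) blast+
  next
    case False
    with iff have "\<not> integrable (completion M) f" "\<not> integrable (completion M) ?g"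
      by (blast dest: borel_measurable_integrable)+
    then show ?thesis by (metis not_integrable_integral_eq)
  qed
  then show ?thesis by (simp add: set_lebesgue_integral_def)
qed

theorem theorem3p13:
  fixes \<mu> :: "'a::metric_space measure" and N :: nat
  assumes "geodesic_space TYPE('a)"
    and "radon_measure \<mu>"
    and "emeasure \<mu> UNIV < \<infinity>"
    and "no_mass_on_nonproper_chains \<mu>"
    and "N > 0"
  shows "geodesic_partial_magnitude \<mu> triv_geodesic_measure N =
           measure \<mu> UNIV +
           (\<Sum>n=1..N. (-1) ^ n *
              (LINT x|prod_measure \<mu> n. exp (- (\<Sum>k=1..n. dist (x (k - 1)) (x k)))))
         \<and> geodesic_partial_magnitude \<mu> triv_geodesic_measure N = partial_magnitude \<mu> N"
proof -
  let ?T = triv_geodesic_measure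
  \<comment> \<open>The indicator vanishes off the proper chains, so the inner integrals need to
    agree only on them.\<close>
  have "(LINT x:proper_chains n|prod_measure \<mu> n.
           (LINT \<gamma>|geodesic_chain_measure ?T n x. exp (- geodesic_chain_length n \<gamma>)))
        = (LINT x:proper_chains n|prod_measure \<mu> n. exp (- chain_length n x))" for n
    unfolding set_lebesgue_integral_def
    by (intro Bochner_Integration.integral_cong)
      (auto simp: indicator_def integral_exp_geodesic_chain_length[OF assms(1)])
  then have eq: "geodesic_partial_magnitude \<mu> ?T N = partial_magnitude \<mu> N"
    by (simp add: geodesic_partial_magnitude_def partial_magnitude_def)
  \<comment> \<open>This makes the ambient set in \<open>no_mass_on_nonproper_chains\<close> the
    space of the product measure.\<close>
  have "space \<mu> = UNIV"
    using assms(2) sets_eq_imp_space_eq[of \<mu> borel] by (simp add: radon_measure_def)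
  then have "(LINT x:proper_chains n|prod_measure \<mu> n. exp (- chain_length n x))
      = (LINT x|prod_measure \<mu> n. exp (- chain_length n x))" if "n \<ge> 1" for n
    using assms(4) that unfolding prod_measure_def no_mass_on_nonproper_chains_def
    by (intro set_lebesgue_integral_completion_conull)
      (auto simp: space_PiM proper_chains_def)
  then have "partial_magnitude \<mu> N = measure \<mu> UNIV +
      (\<Sum>n=1..N. (-1) ^ n * (LINT x|prod_measure \<mu> n. exp (- chain_length n x)))"
    by (simp add: partial_magnitude_def)
  with eq show ?thesis
    by (simp add: chain_length_def)
qed

end
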